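(* For each integer $m>2$ there are harmonic maps $\mathbb{R}^{2m}\to\mathbb{C}$, defined on the whole of $\mathbb{R}^{2m}$, which are holomorphic with respect to a Hermitian structure $J$ on $\mathbb{R}^{2m}$ but not holomorphic with respect to any Kähler structure on $\mathbb{R}^{2m}$, and which factor to full harmonic morphisms from $\mathbb{R}^{2m-1}$ to $\mathbb{C}$. These harmonic morphisms can be chosen to be submersions.
   Context: A harmonic map $\phi:\mathbb{R}^n\to\mathbb{C}$ is a smooth map with $\sum_i \partial^2\phi/(\partial x^i)^2=0$; it is a harmonic morphism if in addition $\sum_i(\partial\phi/\partial x^i)^2=0$. An almost Hermitian structure $J$ on $\mathbb{R}^{2m}$ (Euclidean metric) is a smooth choice, for each $x$, of an orthogonal linear map $J_x:T_x\mathbb{R}^{2m}\to T_x\mathbb{R}^{2m}$ with $J_x^2=-I$. It is called a Hermitian structure if it is integrable (every point has a neighbourhood with a chart $\psi$ into $\mathbb{C}^m$ satisfying $d\psi\circ J=\mathrm{i}\,d\psi$), and a Kähler structure if it is parallel, i.e. constant in $x$. A map $\phi$ is holomorphic with respect to $J$ if $d\phi(JX)=\mathrm{i}\,d\phi(X)$ for all tangent vectors $X$. A map $\phi:\mathbb{R}^{2m}\to\mathbb{C}$ factors to $\psi:\mathbb{R}^{2m-1}\to\mathbb{C}$ if $\phi=\psi\circ\pi$ where $\pi$ is orthogonal projection onto a $(2m-1)$-dimensional linear subspace, identified isometrically with $\mathbb{R}^{2m-1}$. A map $\phi:\mathbb{R}^n\to\mathbb{C}$ is full if it cannot be written as $\phi=\psi\circ\pi_A$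 for some orthogonal projection $\pi_A$ of $\mathbb{R}^n$ onto a proper linear subspace $A$ and some map $\psi:A\to\mathbb{C}$. *)

theory Defs
  imports "HOL-Analysis.Analysis"
begin

text \<open>
  Tangent spaces of Euclidean space are identified with the space itself, and the differential
  of \<open>f\<close> at \<open>x\<close> is \<open>frechet_derivative f (at x)\<close>.  On an open set \<open>S\<close>, being of class
  \<open>C^(k+1)\<close> means being differentiable with every directional derivative of class \<open>C^k\<close>.
\<close>

primrec Ck_on :: "nat \<Rightarrow> ('a::euclidean_space) set \<Rightarrow> ('a \<Rightarrow> 'b::real_normed_vector) \<Rightarrow> bool"
  where
    "Ck_on 0 S f \<longleftrightarrow> continuous_on S f"
  | "Ck_on (Suc k) S f \<longleftrightarrow>
       (\<forall>x\<in>S. f differentiable at x) \<and>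
       (\<forall>v. Ck_on k S (\<lambda>x. frechet_derivative f (at x) v))"

definition smooth_on :: "('a::euclidean_space) set \<Rightarrow> ('a \<Rightarrow> 'b::real_normed_vector) \<Rightarrow> bool"
  where "smooth_on S f \<longleftrightarrow> open S \<and> (\<forall>k. Ck_on k S f)"

definition diffeomorphism ::
    "('a::euclidean_space) set \<Rightarrow> ('b::euclidean_space) set \<Rightarrow> ('a \<Rightarrow> 'b) \<Rightarrow> ('b \<Rightarrow> 'a) \<Rightarrow> bool"
  where "diffeomorphism U V f g \<longleftrightarrow> homeomorphism U V f g \<and> smooth_on U f \<and> smooth_on V g"

definition partial_deriv ::
    "'n \<Rightarrow> (real^'n::finite \<Rightarrow> complex) \<Rightarrow> real^'n \<Rightarrow> complex"
  where "partial_deriv i f x = frechet_derivative f (at x) (axis i 1)"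

definition harmonic_map :: "(real^'n::finite \<Rightarrow> complex) \<Rightarrow> bool"
  where "harmonic_map f \<longleftrightarrow>
    smooth_on UNIV f \<and> (\<forall>x. (\<Sum>i\<in>UNIV. partial_deriv i (partial_deriv i f) x) = 0)"

definition harmonic_morphism :: "(real^'n::finite \<Rightarrow> complex) \<Rightarrow> bool"
  where "harmonic_morphism f \<longleftrightarrow>
    harmonic_map f \<and> (\<forall>x. (\<Sum>i\<in>UNIV. (partial_deriv i f x)^2) = 0)"

definition submersion :: "(real^'n::finite \<Rightarrow> complex) \<Rightarrow> bool"
  where "submersion f \<longleftrightarrow>
    smooth_on UNIV f \<and> (\<forall>x. surj (frechet_derivative f (at x)))"

text \<open>
  Since each \<open>J x\<close> is linear, smoothness of \<open>x \<mapsto> J x\<close> is smoothness of \<open>x \<mapsto> J x v\<close>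
  for every fixed vector \<open>v\<close>, that is, of all matrix entries.
\<close>

definition almost_hermitian_structure :: "(real^'n::finite \<Rightarrow> real^'n \<Rightarrow> real^'n) \<Rightarrow> bool"
  where "almost_hermitian_structure J \<longleftrightarrow>
    (\<forall>x. orthogonal_transformation (J x) \<and> (\<forall>v. J x (J x v) = - v)) \<and>
    (\<forall>v. smooth_on UNIV (\<lambda>x. J x v))"

text \<open>The type argument supplies the index type \<open>'m\<close> of the target \<open>complex^'m\<close> of the charts.\<close>

definition hermitian_structure ::
    "'m::finite itself \<Rightarrow> (real^'n::finite \<Rightarrow> real^'n \<Rightarrow> real^'n) \<Rightarrow> bool"
  where "hermitian_structure TYPE('m) J \<longleftrightarrow>
    almost_hermitian_structure J \<and>
    (\<forall>x. \<exists>U V (\<psi> :: real^'n \<Rightarrow> complex^'m) \<theta>.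
       x \<in> U \<and> diffeomorphism U V \<psi> \<theta> \<and>
       (\<forall>y\<in>U. \<forall>v. frechet_derivative \<psi> (at y) (J y v) = \<i> *s frechet_derivative \<psi> (at y) v))"

definition kaehler_structure :: "(real^'n::finite \<Rightarrow> real^'n \<Rightarrow> real^'n) \<Rightarrow> bool"
  where "kaehler_structure J \<longleftrightarrow> almost_hermitian_structure J \<and> (\<forall>x y. J x = J y)"

definition holomorphic_wrt ::
    "(real^'n::finite \<Rightarrow> real^'n \<Rightarrow> real^'n) \<Rightarrow> (real^'n \<Rightarrow> complex) \<Rightarrow> bool"
  where "holomorphic_wrt J f \<longleftrightarrow>
    (\<forall>x. f differentiable at x \<and>
      (\<forall>v. frechet_derivative f (at x) (J x v) = \<i> * frechet_derivative f (at x) v))"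

definition orthogonal_projection_onto ::
    "('a::euclidean_space) set \<Rightarrow> ('a \<Rightarrow> 'a) \<Rightarrow> bool"
  where "orthogonal_projection_onto A p \<longleftrightarrow> (\<forall>x. p x \<in> A \<and> x - p x \<in> orthogonal_comp A)"

text \<open>
  In \<open>factors_to\<close>, \<open>\<iota>\<close> identifies the subspace \<open>W\<close> isometrically with \<open>real^'k\<close>; its values
  off \<open>W\<close> play no role.
\<close>

definition factors_to ::
    "(real^'n::finite \<Rightarrow> complex) \<Rightarrow> (real^'k::finite \<Rightarrow> complex) \<Rightarrow> bool"
  where "factors_to f g \<longleftrightarrow>
    (\<exists>W p (\<iota> :: real^'n \<Rightarrow> real^'k).
       subspace W \<and> dim W = CARD('k) \<and> orthogonal_projection_onto W p \<and>
       linear \<iota> \<and> (\<forall>w\<in>W. norm (\<iota> w) = norm w) \<and> \<iota> ` W = UNIV \<and>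
       f = g \<circ> (\<iota> \<circ> p))"

text \<open>A map on \<open>A\<close> is represented by a total map; only its values on \<open>A\<close> enter.\<close>

definition full :: "(real^'n::finite \<Rightarrow> complex) \<Rightarrow> bool"
  where "full f \<longleftrightarrow>
    \<not> (\<exists>A p (g :: real^'n \<Rightarrow> complex).
        subspace A \<and> A \<noteq> UNIV \<and> orthogonal_projection_onto A p \<and> f = g \<circ> p)"

end

theory Submission
  imports Defs
begin

text \<open>
  Identify \<open>real^'n\<close> with complex coordinates \<open>q_j\<close>, \<open>j \<in> 'm\<close>, fix three distinct indices
  \<open>a, b, c\<close> and write \<open>z = q_c\<close>.  Let \<open>J\<close> be multiplication by \<open>\<i>\<close> on the coordinates other than
  \<open>q_a, q_b\<close>, and on the \<open>(q_a, q_b)\<close>-plane the Hermitian structure of \<open>\<real>^4\<close> whose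
  holomorphic coordinates are \<open>q_a - z cnj q_b\<close> and \<open>q_b + z cnj q_a\<close>.  As it depends
  holomorphically on \<open>z\<close>, the structure is integrable, with a global chart.  The function
  \<open>\<phi> = (q_b + z cnj q_a) - z (q_a - z cnj q_b) + (\<Sum>j\<notin>{a,b}. q_j^2)\<close>
  is holomorphic for \<open>J\<close>, and it depends on \<open>q_a\<close> only through \<open>Im q_a\<close>, so it descends to
  the hyperplane \<open>Re q_a = 0\<close>.  Its differential at \<open>x\<close>, restricted to the
  \<open>(q_a, q_b)\<close>-plane, turns with \<open>z\<close> in a way that no constant complex structure allows; the
  differentials have no common zero direction in the hyperplane; and an isotropic covector
  is surjective as soon as it is nonzero.
\<close>

section \<open>Calculus of smooth maps\<close>

lemma frechet_derivative_eq:
  "(f has_derivative f') (at x) \<Longrightarrow> frechet_derivative f (at x) = f'"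
  by (rule frechet_derivative_at[symmetric])

lemma has_frechet_derivative:
  "f differentiable at x \<Longrightarrow> (f has_derivative frechet_derivative f (at x)) (at x)"
  by (simp add: frechet_derivative_works)

text \<open>Since \<open>S\<close> is open, maps that agree on \<open>S\<close> have the same
  derivative at each of its points, so the induction passes to directional derivatives.\<close>

lemma Ck_on_cong:
  assumes "open S" "\<And>x. x \<in> S \<Longrightarrow> f x = g x" "Ck_on k S f"
  shows "Ck_on k S g"
  using assms(2,3)
proof (induction k arbitrary: f g)
  case 0
  then show ?case by (auto cong: continuous_on_cong)
next
  case (Suc k)
  have D: "(g has_derivative frechet_derivative f (at x)) (at x)" if "x \<in> S" for x
    by (rule has_derivative_transform_within_open[OF has_frechet_derivative assms(1) that])
      (use Suc.prems that in auto)
  have "Ck_on k S (\<lambda>x. frechet_derivative g (at x) v)" for v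
    by (rule Suc.IH[where f = "\<lambda>x. frechet_derivative f (at x) v"])
      (use Suc.prems in \<open>simp_all add: frechet_derivative_eq[OF D]\<close>)
  then show ?case using differentiableI[OF D] by simp
qed

text \<open>Lets each closure rule below supply whatever derivative it can compute, in place of
  \<open>frechet_derivative\<close>.\<close>

lemma Ck_on_SucI:
  assumes "open S" "\<And>x. x \<in> S \<Longrightarrow> (f has_derivative f' x) (at x)"
    and "\<And>v. Ck_on k S (\<lambda>x. f' x v)"
  shows "Ck_on (Suc k) S f"
proof -
  have "Ck_on k S (\<lambda>x. frechet_derivative f (at x) v)" for v
    by (rule Ck_on_cong[OF assms(1) _ assms(3)[of v]]) (simp add: frechet_derivative_eq[OF assms(2)])
  moreover have "f differentiable at x" if "x \<in> S" for x
    using assms(2)[OF that] by (rule differentiableI)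
  ultimately show ?thesis by simp
qed

text \<open>The base case is that differentiability implies continuity. Products and inverses rely
  on this, as their derivatives still contain undifferentiated factors.\<close>

lemma Ck_on_SucD: "Ck_on (Suc k) S f \<Longrightarrow> Ck_on k S f"
proof (induction k arbitrary: f)
  case 0
  then have "continuous (at x within S) f" if "x \<in> S" for x
    using that by (simp add: differentiable_imp_continuous_within differentiable_at_withinI)
  then show ?case by (simp add: continuous_on_eq_continuous_within)
next
  case (Suc k)
  then show ?case by (metis Ck_on.simps(2))
qed

lemma Ck_on_const:
  assumes "open S"
  shows "Ck_on k S (\<lambda>x. c)"
proof (induction k arbitrary: c)
  case (Suc k)
  show ?case by (rule Ck_on_SucI[OF assms has_derivative_const Suc])
qed simp

lemma Ck_on_bounded_linear:
  assumes "open S" "bounded_linear L"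
  shows "Ck_on k S L"
proof (cases k)
  case 0
  then show ?thesis by (simp add: assms linear_continuous_on)
next
  case (Suc n)
  show ?thesis
    unfolding Suc
    by (rule Ck_on_SucI[OF assms(1) bounded_linear_imp_has_derivative[OF assms(2)] Ck_on_const[OF assms(1)]])
qed

lemma Ck_on_compose_bounded_linear:
  assumes "open S" "bounded_linear L" "Ck_on k S f"
  shows "Ck_on k S (\<lambda>x. L (f x))"
  using assms(3)
proof (induction k arbitrary: f)
  case 0
  then show ?case by (simp add: bounded_linear.continuous_on[OF assms(2)])
next
  case (Suc k)
  show ?case
    by (rule Ck_on_SucI[OF assms(1) bounded_linear.has_derivative[OF assms(2) has_frechet_derivative]])
      (use Suc in auto)
qed

text \<open>With a linear inner map, each directional derivative of the composite is again such a
  composite, so the induction closes without a product rule.\<close>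

lemma Ck_on_precompose_bounded_linear:
  assumes "bounded_linear L" "Ck_on k UNIV f"
  shows "Ck_on k UNIV (\<lambda>x. f (L x))"
  using assms(2)
proof (induction k arbitrary: f)
  case 0
  then show ?case
    using linear_continuous_on[OF assms(1)] by (auto intro: continuous_on_compose2)
next
  case (Suc k)
  show ?case
    by (rule Ck_on_SucI[OF open_UNIV
          has_derivative_compose[OF bounded_linear_imp_has_derivative[OF assms(1)] has_frechet_derivative]])
      (use Suc in auto)
qed

lemma Ck_on_add:
  assumes "open S" "Ck_on k S f" "Ck_on k S g"
  shows "Ck_on k S (\<lambda>x. f x + g x)"
  using assms(2,3)
proof (induction k arbitrary: f g)
  case 0
  then show ?case by (simp add: continuous_on_add)
next
  case (Suc k)
  show ?case
    by (rule Ck_on_SucI[OF assms(1) has_derivative_add[OF has_frechet_derivative has_frechet_derivative]])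
      (use Suc in auto)
qed

lemma Ck_on_mult:
  fixes f g :: "'a::euclidean_space \<Rightarrow> 'b::real_normed_algebra"
  assumes "open S" "Ck_on k S f" "Ck_on k S g"
  shows "Ck_on k S (\<lambda>x. f x * g x)"
  using assms(2,3)
proof (induction k arbitrary: f g)
  case 0
  then show ?case by (simp add: continuous_on_mult)
next
  case (Suc k)
  show ?case
    by (rule Ck_on_SucI[OF assms(1) has_derivative_mult[OF has_frechet_derivative has_frechet_derivative]])
      (use Suc Suc.prems[THEN Ck_on_SucD] in \<open>auto intro!: Ck_on_add assms(1)\<close>)
qed

text \<open>The derivative of 1/f is -(1/f) f' (1/f), so the regularity of 1/f feeds back into
  itself one order at a time.\<close>

lemma Ck_on_inverse:
  fixes f :: "'a::euclidean_space \<Rightarrow> 'b::real_normed_field"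
  assumes "open S" "\<And>x. x \<in> S \<Longrightarrow> f x \<noteq> 0" "Ck_on k S f"
  shows "Ck_on k S (\<lambda>x. inverse (f x))"
  using assms(3)
proof (induction k)
  case 0
  then show ?case using assms(2) by (simp add: continuous_on_inverse)
next
  case (Suc k)
  have inv: "Ck_on k S (\<lambda>x. inverse (f x))"
    using Suc Ck_on_SucD by blast
  show ?case
  proof (rule Ck_on_SucI[OF assms(1)])
    show "((\<lambda>x. inverse (f x)) has_derivative
        (\<lambda>v. - (inverse (f x) * frechet_derivative f (at x) v * inverse (f x)))) (at x)" if "x \<in> S" for x
      by (rule Deriv.has_derivative_inverse) (use assms(2) Suc.prems that in \<open>auto simp: has_frechet_derivative\<close>)
    show "Ck_on k S (\<lambda>x. - (inverse (f x) * frechet_derivative f (at x) v * inverse (f x)))" for v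
      by (rule Ck_on_compose_bounded_linear[OF assms(1) bounded_linear_minus[OF bounded_linear_ident]])
        (use inv Suc.prems in \<open>auto intro!: Ck_on_mult assms(1)\<close>)
  qed
qed

section \<open>Closure properties of smooth maps\<close>

named_theorems smooth_intros

lemma smooth_on_const [smooth_intros]: "open S \<Longrightarrow> smooth_on S (\<lambda>x. c)"
  by (simp add: smooth_on_def Ck_on_const)

lemma smooth_on_bounded_linear: "open S \<Longrightarrow> bounded_linear L \<Longrightarrow> smooth_on S L"
  by (simp add: smooth_on_def Ck_on_bounded_linear)

lemma smooth_on_compose_bounded_linear:
  "bounded_linear L \<Longrightarrow> smooth_on S f \<Longrightarrow> smooth_on S (\<lambda>x. L (f x))"
  by (simp add: smooth_on_def Ck_on_compose_bounded_linear)

lemma smooth_on_precompose_bounded_linear: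
  "bounded_linear L \<Longrightarrow> smooth_on UNIV f \<Longrightarrow> smooth_on UNIV (\<lambda>x. f (L x))"
  by (simp add: smooth_on_def Ck_on_precompose_bounded_linear)

lemma smooth_on_add [smooth_intros]:
  "smooth_on S f \<Longrightarrow> smooth_on S g \<Longrightarrow> smooth_on S (\<lambda>x. f x + g x)"
  by (simp add: smooth_on_def Ck_on_add)

lemma smooth_on_minus [smooth_intros]: "smooth_on S f \<Longrightarrow> smooth_on S (\<lambda>x. - f x)"
  by (rule smooth_on_compose_bounded_linear[OF bounded_linear_minus[OF bounded_linear_ident]])

lemma smooth_on_diff [smooth_intros]:
  "smooth_on S f \<Longrightarrow> smooth_on S g \<Longrightarrow> smooth_on S (\<lambda>x. f x - g x)"
  using smooth_on_add[of S f "\<lambda>x. - g x"] smooth_on_minus[of S g] by simp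

lemma smooth_on_mult [smooth_intros]:
  fixes f g :: "'a::euclidean_space \<Rightarrow> 'b::real_normed_algebra"
  shows "smooth_on S f \<Longrightarrow> smooth_on S g \<Longrightarrow> smooth_on S (\<lambda>x. f x * g x)"
  by (simp add: smooth_on_def Ck_on_mult)

lemma smooth_on_power [smooth_intros]:
  fixes f :: "'a::euclidean_space \<Rightarrow> 'b::real_normed_algebra_1"
  assumes "smooth_on S f"
  shows "smooth_on S (\<lambda>x. f x ^ n)"
proof (induction n)
  case 0
  have "open S" using assms by (simp add: smooth_on_def)
  then show ?case by (simp add: smooth_on_const)
next
  case (Suc n)
  then show ?case by (simp add: smooth_on_mult assms)
qed

lemma smooth_on_divide [smooth_intros]:
  fixes f g :: "'a::euclidean_space \<Rightarrow> 'b::real_normed_field"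
  shows "smooth_on S f \<Longrightarrow> smooth_on S g \<Longrightarrow> (\<And>x. x \<in> S \<Longrightarrow> g x \<noteq> 0) \<Longrightarrow>
    smooth_on S (\<lambda>x. f x / g x)"
  by (simp add: smooth_on_def divide_inverse Ck_on_mult Ck_on_inverse)

lemma smooth_on_cnj [smooth_intros]: "smooth_on S f \<Longrightarrow> smooth_on S (\<lambda>x. cnj (f x))"
  by (rule smooth_on_compose_bounded_linear[OF bounded_linear_cnj])

lemma smooth_on_sum [smooth_intros]:
  "open S \<Longrightarrow> (\<And>i. i \<in> I \<Longrightarrow> smooth_on S (f i)) \<Longrightarrow> smooth_on S (\<lambda>x. \<Sum>i\<in>I. f i x)"
  by (induction I rule: infinite_finite_induct) (simp_all add: smooth_on_const smooth_on_add)

lemma bounded_linear_axis: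
  "bounded_linear (axis j :: 'b::euclidean_space \<Rightarrow> 'b^'m::finite)"
  unfolding linear_conv_bounded_linear[symmetric]
  by (rule linearI) (simp_all add: axis_def vec_eq_iff)

text \<open>A vector is the sum of its components placed along the axes, and \<open>axis j\<close>
  is bounded linear; this avoids a separate induction on the order.\<close>

lemma smooth_on_vec:
  assumes "open S" "\<And>j. smooth_on S (\<lambda>x. f x $ j)"
  shows "smooth_on S (f :: 'a::euclidean_space \<Rightarrow> 'b::euclidean_space ^ 'm)"
proof -
  have "smooth_on S (\<lambda>x. \<Sum>j\<in>UNIV. axis j (f x $ j))"
    by (rule smooth_on_sum[OF assms(1) smooth_on_compose_bounded_linear[OF bounded_linear_axis assms(2)]])
  moreover have "(\<Sum>j\<in>UNIV. axis j (f x $ j)) = f x" for x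
    by (simp add: vec_eq_iff axis_def)
  ultimately show ?thesis by simp
qed

lemma smooth_on_imp_differentiable: "smooth_on S f \<Longrightarrow> x \<in> S \<Longrightarrow> f differentiable at x"
  using Ck_on.simps(2)[of 0 S f] by (auto simp: smooth_on_def simp del: Ck_on.simps)

lemma smooth_on_frechet_derivative:
  assumes "smooth_on S f"
  shows "smooth_on S (\<lambda>x. frechet_derivative f (at x) v)"
proof -
  have "Ck_on (Suc k) S f" for k using assms by (simp only: smooth_on_def)
  then show ?thesis using assms by (simp add: smooth_on_def)
qed

lemma has_derivative_vec_lambda:
  fixes f :: "'m::finite \<Rightarrow> 'a::real_normed_vector \<Rightarrow> 'b::euclidean_space"
  assumes "\<And>j. (f j has_derivative f' j) F"
  shows "((\<lambda>x. \<chi> j. f j x) has_derivative (\<lambda>v. \<chi> j. f' j v)) F"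
proof -
  have "((\<lambda>x. \<Sum>j\<in>UNIV. axis j (f j x)) has_derivative (\<lambda>v. \<Sum>j\<in>UNIV. axis j (f' j v))) F"
    by (rule has_derivative_sum[OF bounded_linear.has_derivative[OF bounded_linear_axis assms]])
  moreover have "(\<Sum>j\<in>UNIV. axis j (g j)) = (\<chi> j. g j)" for g :: "'m \<Rightarrow> 'b"
    by (simp add: vec_eq_iff axis_def)
  ultimately show ?thesis by simp
qed

section \<open>Isotropic differentials and full maps\<close>

text \<open>Isotropy says that the real and imaginary parts of \<open>D\<close> are orthogonal and
  of equal length, hence independent when \<open>D\<close> is nonzero. The proof exhibits a
  preimage.\<close>

lemma isotropic_imp_surj:
  fixes D :: "real^'n::finite \<Rightarrow> complex"
  assumes "linear D" "(\<Sum>i\<in>UNIV. (D (axis i 1))^2) = 0" "D v \<noteq> 0"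
  shows "surj D"
proof (rule surjI)
  let ?d = "\<lambda>i. D (axis i 1)"
  have D: "D x = (\<Sum>i\<in>UNIV. of_real (x $ i) * ?d i)" for x
  proof -
    have "x = (\<Sum>i\<in>UNIV. x $ i *\<^sub>R axis i 1)"
      by (simp only: scalar_mult_eq_scaleR[symmetric] basis_expansion)
    from arg_cong[OF this, of D] have "D x = (\<Sum>i\<in>UNIV. x $ i *\<^sub>R ?d i)"
      by (simp only: linear_sum[OF assms(1)] linear_cmul[OF assms(1)])
    then show ?thesis by (simp only: scaleR_conv_of_real)
  qed
  define N where "N = (\<Sum>i\<in>UNIV. (cmod (?d i))\<^sup>2)"
  have "N \<noteq> 0"
  proof
    assume "N = 0"
    then have "?d i = 0" for i by (simp add: N_def sum_nonneg_eq_0_iff)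
    then show False using assms(3) D[of v] by simp
  qed
  fix w
  \<comment> \<open>This is the real vector (w cnj d + cnj w d) / N, where d is the covector of
    \<open>D\<close>. Pairing with d turns the first part into w, because N is the sum of |d_i|^2;
    the second part becomes a multiple of the sum of d_i^2, which is zero.\<close>
  let ?x = "\<chi> i. 2 * Re (w * cnj (?d i)) / N"
  have coeff: "of_real N * of_real (?x $ i) = w * cnj (?d i) + cnj w * ?d i" for i
    using \<open>N \<noteq> 0\<close> by (simp add: complex_eq_iff field_simps)
  have "of_real N * D ?x = (\<Sum>i\<in>UNIV. (w * cnj (?d i) + cnj w * ?d i) * ?d i)"
    unfolding D[of ?x] sum_distrib_left mult.assoc[symmetric] coeff ..
  also have "\<dots> = w * of_real N + cnj w * (\<Sum>i\<in>UNIV. (?d i)\<^sup>2)"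
    unfolding N_def of_real_sum sum_distrib_left sum.distrib[symmetric] complex_norm_square
    by (intro sum.cong refl) (simp add: algebra_simps power2_eq_square)
  finally show "D ?x = w" using assms(2) \<open>N \<noteq> 0\<close> by simp
qed

text \<open>The differentials of a harmonic morphism are isotropic, so only their nonvanishing has
  to be checked.\<close>

lemma harmonic_morphism_imp_submersion:
  assumes "harmonic_morphism f" "\<And>x. \<exists>v. frechet_derivative f (at x) v \<noteq> 0"
  shows "submersion f"
proof -
  have smooth: "smooth_on UNIV f"
    using assms(1) by (simp add: harmonic_morphism_def harmonic_map_def)
  have "surj (frechet_derivative f (at x))" for x
  proof -
    have "Ck_on (Suc 0) UNIV f" using smooth by (simp only: smooth_on_def)
    then have lin: "linear (frechet_derivative f (at x))"
      by (simp add: linear_frechet_derivative)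
    obtain v where "frechet_derivative f (at x) v \<noteq> 0" using assms(2) by blast
    moreover have "(\<Sum>i\<in>UNIV. (frechet_derivative f (at x) (axis i 1))\<^sup>2) = 0"
      using assms(1) by (simp add: harmonic_morphism_def partial_deriv_def)
    ultimately show ?thesis using isotropic_imp_surj[OF lin] by blast
  qed
  then show ?thesis using smooth by (simp add: submersion_def)
qed

text \<open>A map factoring through a proper subspace is constant along any direction orthogonal to it.\<close>

lemma fullI:
  assumes diff: "\<And>x. f differentiable at x"
    and "\<And>u. (\<And>x. frechet_derivative f (at x) u = 0) \<Longrightarrow> u = 0"
  shows "full f"
  unfolding full_def
proof (intro notI, elim exE conjE)
  fix A p g
  assume A: "subspace A" "A \<noteq> UNIV" "orthogonal_projection_onto A p" "f = g \<circ> p"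
  obtain x where "x \<notin> A" using A(2) by blast
  define u where "u = x - p x"
  have p: "p y \<in> A" "y - p y \<in> orthogonal_comp A" for y
    using A(3) by (auto simp: orthogonal_projection_onto_def)
  have "u \<noteq> 0" using p(1)[of x] \<open>x \<notin> A\<close> by (auto simp: u_def)
  \<comment> \<open>The definition gives \<open>p\<close> only pointwise, so linearity is not at
    hand. Instead the difference of the two values lies both in \<open>A\<close> and in its
    orthogonal complement.\<close>
  have "p (y + t *\<^sub>R u) = p y" for y t
  proof -
    let ?d = "p (y + t *\<^sub>R u) - p y"
    have "?d = (y - p y) - (y + t *\<^sub>R u - p (y + t *\<^sub>R u)) + t *\<^sub>R u" by simp
    also have "\<dots> \<in> orthogonal_comp A"
      unfolding u_def
      by (intro subspace_add subspace_diff subspace_scale subspace_orthogonal_comp p)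
    finally have "orthogonal ?d ?d"
      using subspace_diff[OF A(1) p(1) p(1)] by (auto simp: orthogonal_comp_def)
    then show ?thesis by (simp add: orthogonal_self)
  qed
  then have const: "f (y + t *\<^sub>R u) = f y" for y t by (simp add: A(4))
  have "frechet_derivative f (at y) u = 0" for y
  proof -
    have "((\<lambda>t. f (y + t *\<^sub>R u)) has_derivative (\<lambda>t. frechet_derivative f (at y) (t *\<^sub>R u))) (at 0)"
    proof (rule has_derivative_compose[where f = "\<lambda>t. y + t *\<^sub>R u"])
      show "((\<lambda>t. y + t *\<^sub>R u) has_derivative (\<lambda>t. t *\<^sub>R u)) (at 0)"
        by (auto intro!: derivative_eq_intros)
      show "(f has_derivative frechet_derivative f (at y)) (at (y + 0 *\<^sub>R u))"
        using has_frechet_derivative[OF diff[of y]] by simp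
    qed
    moreover have "((\<lambda>t. f (y + t *\<^sub>R u)) has_derivative (\<lambda>t. 0)) (at (0::real))"
      by (simp add: const)
    ultimately have "(\<lambda>t. frechet_derivative f (at y) (t *\<^sub>R u)) = (\<lambda>t. 0)"
      by (rule has_derivative_unique)
    then show ?thesis by (metis scaleR_one)
  qed
  then show False using assms(2) \<open>u \<noteq> 0\<close> by blast
qed

section \<open>Maps independent of one coordinate\<close>

locale coordinate_hyperplane =
  fixes e :: "'k::finite \<Rightarrow> 'n::finite" and i0 :: 'n
  assumes bij_e: "bij_betw e UNIV (- {i0})"
begin

text \<open>The index \<open>i0\<close> is outside the range of \<open>e\<close>, so
  \<open>inv e i0\<close> carries no information and the coordinate is set to 0 explicitly.\<close>

definition embed :: "real^'k \<Rightarrow> real^'n" where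
  "embed y = (\<chi> i. if i = i0 then 0 else y $ inv e i)"

definition restr :: "real^'n \<Rightarrow> real^'k" where
  "restr x = (\<chi> k. x $ e k)"

lemma inv_e [simp]: "inv e (e k) = k"
  using bij_e by (simp add: bij_betw_def)

lemma e_neq [simp]: "e k \<noteq> i0"
  using bij_e by (auto simp: bij_betw_def)

lemma e_inv: "i \<noteq> i0 \<Longrightarrow> e (inv e i) = i"
  using bij_e by (auto simp: bij_betw_def intro!: f_inv_into_f)

lemma embed_nth [simp]: "embed y $ i0 = 0" "embed y $ e k = y $ k"
  by (simp_all add: embed_def)

lemma restr_nth [simp]: "restr x $ k = x $ e k"
  by (simp add: restr_def)

lemma vec_eq_hyperplane:
  assumes "x $ i0 = y $ i0" "\<And>k. x $ e k = y $ e k"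
  shows "x = (y :: real^'n)"
  unfolding vec_eq_iff using assms by (metis e_inv)

lemma embed_axis: "embed (axis k 1) = axis (e k) 1"
  by (rule vec_eq_hyperplane) (auto simp: axis_def e_neq[symmetric] dest: arg_cong[of _ _ "inv e"])

lemma embed_restr: "x $ i0 = 0 \<Longrightarrow> embed (restr x) = x"
  by (rule vec_eq_hyperplane) auto

lemma embed_restr_axis: "embed (restr (axis i0 1)) = 0"
  by (rule vec_eq_hyperplane) (auto simp: axis_def e_neq[symmetric])

lemma bounded_linear_embed: "bounded_linear embed"
  unfolding linear_conv_bounded_linear[symmetric]
  by (rule linearI) (auto simp: embed_def vec_eq_iff)

lemma bounded_linear_restr: "bounded_linear restr"
  unfolding linear_conv_bounded_linear[symmetric]
  by (rule linearI) (auto simp: restr_def vec_eq_iff)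

lemma sum_hyperplane: "(\<Sum>i\<in>UNIV. g i) = g i0 + (\<Sum>k\<in>UNIV. g (e k))"
  by (simp add: sum.remove[of UNIV i0] sum.reindex_bij_betw[OF bij_e, of g] Compl_eq_Diff_UNIV)

text \<open>Gives both the orthogonality of the projection \<open>embed (restr x)\<close> and the
  isometry of \<open>restr\<close> on the hyperplane.\<close>

lemma inner_hyperplane: "x \<bullet> y = x $ i0 * y $ i0 + restr x \<bullet> restr y"
  by (simp add: inner_vec_def sum_hyperplane[of "\<lambda>i. x $ i * y $ i"])

text \<open>The subspace is the hyperplane where coordinate \<open>i0\<close> vanishes, identified
  with \<open>real^'k\<close> by \<open>restr\<close>. The factorisation applies the hypothesis
  twice, as the projection is followed by \<open>restr\<close> and \<open>embed\<close>.\<close>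

lemma factors_to_embed:
  assumes "\<And>x. f (embed (restr x)) = f x"
  shows "factors_to f (\<lambda>y. f (embed y))"
  unfolding factors_to_def
proof (intro exI conjI)
  let ?W = "{x :: real^'n. x $ i0 = 0}" and ?p = "\<lambda>x. embed (restr x)"
  have eq: "?W = {x. axis i0 1 \<bullet> x = 0}" by (simp add: inner_axis')
  show "subspace ?W" unfolding eq by (rule subspace_hyperplane)
  \<comment> \<open>Summing the constant 1 over all indices counts them.\<close>
  have "CARD('n) = Suc CARD('k)"
    using sum_hyperplane[of "\<lambda>_. 1::nat"] by simp
  then show "dim ?W = CARD('k)"
    unfolding eq by (subst dim_hyperplane) (auto simp: axis_eq_0_iff)
  show "orthogonal_projection_onto ?W ?p"
    unfolding orthogonal_projection_onto_def
    by (auto simp: orthogonal_comp_def orthogonal_def inner_hyperplane inner_diff_left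
        restr_def inner_vec_def)
  show "linear restr" using bounded_linear_restr by (rule bounded_linear.linear)
  show "\<forall>w\<in>?W. norm (restr w) = norm w" by (auto simp: norm_eq_sqrt_inner inner_hyperplane)
  show "restr ` ?W = UNIV"
  proof (intro equalityI subset_UNIV subsetI)
    fix y :: "real^'k"
    have "restr (embed y) = y" by (simp add: vec_eq_iff)
    then show "y \<in> restr ` ?W" by (intro image_eqI[of _ _ "embed y"]) auto
  qed
  show "f = (\<lambda>y. f (embed y)) \<circ> (restr \<circ> ?p)"
    using assms by (simp add: fun_eq_iff)
qed

lemma has_derivative_embed:
  assumes "f differentiable at (embed y)"
  shows "((\<lambda>y. f (embed y)) has_derivative (\<lambda>v. frechet_derivative f (at (embed y)) (embed v))) (at y)"
  by (rule has_derivative_compose[OF bounded_linear_imp_has_derivative[OF bounded_linear_embed]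
        has_frechet_derivative[OF assms]])

lemma partial_deriv_embed:
  assumes "\<And>x. f differentiable at x"
  shows "partial_deriv k (\<lambda>y. f (embed y)) = (\<lambda>y. partial_deriv (e k) f (embed y))"
  by (simp add: fun_eq_iff partial_deriv_def frechet_derivative_eq[OF has_derivative_embed[OF assms]]
      embed_axis)

text \<open>Differentiate the invariance of \<open>f\<close> in the direction
  \<open>axis i0 1\<close>, which \<open>embed (restr x)\<close> sends to 0.\<close>

lemma partial_deriv_normal:
  assumes diff: "\<And>x. f differentiable at x" and "\<And>x. f (embed (restr x)) = f x"
  shows "partial_deriv i0 f = (\<lambda>x. 0)"
proof
  fix x
  have "((\<lambda>x. f (embed (restr x))) has_derivative
      (\<lambda>v. frechet_derivative f (at (embed (restr x))) (embed (restr v)))) (at x)"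
    by (rule has_derivative_compose[OF bounded_linear_imp_has_derivative[OF bounded_linear_restr]
          has_derivative_embed[OF diff]])
  then have "frechet_derivative f (at x) (axis i0 1) =
      frechet_derivative f (at (embed (restr x))) 0"
    unfolding assms(2) by (simp add: frechet_derivative_eq embed_restr_axis)
  then show "partial_deriv i0 f x = 0"
    by (simp add: partial_deriv_def linear_0[OF linear_frechet_derivative[OF diff]])
qed

text \<open>The sums over \<open>'n\<close> and over \<open>'k\<close> differ by the
  \<open>i0\<close> term alone, and that term vanishes in both equations by
  \<open>partial_deriv_normal\<close>.\<close>

lemma harmonic_morphism_embed:
  assumes hm: "harmonic_morphism f" and indep: "\<And>x. f (embed (restr x)) = f x"
  shows "harmonic_morphism (\<lambda>y. f (embed y))"
proof -
  have smooth: "smooth_on UNIV f"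
    using hm by (simp add: harmonic_morphism_def harmonic_map_def)
  have diff: "f differentiable at x" for x
    using smooth_on_imp_differentiable[OF smooth] by simp
  have diff': "partial_deriv i f differentiable at x" for i x
    using smooth_on_imp_differentiable[OF smooth_on_frechet_derivative[OF smooth, of "axis i 1"], of x]
    by (simp add: partial_deriv_def[abs_def])
  note normal = partial_deriv_normal[OF diff indep]
  have "partial_deriv i0 (\<lambda>x. 0) = (\<lambda>x. 0)"
    by (simp add: fun_eq_iff partial_deriv_def frechet_derivative_const)
  then have "(\<Sum>k\<in>UNIV. partial_deriv k (partial_deriv k (\<lambda>y. f (embed y))) y) = 0" for y
    using hm sum_hyperplane[of "\<lambda>i. partial_deriv i (partial_deriv i f) (embed y)"]
    by (simp add: partial_deriv_embed[OF diff] partial_deriv_embed[OF diff'] normal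
        harmonic_morphism_def harmonic_map_def)
  moreover have "(\<Sum>k\<in>UNIV. (partial_deriv k (\<lambda>y. f (embed y)) y)\<^sup>2) = 0" for y
    using hm sum_hyperplane[of "\<lambda>i. (partial_deriv i f (embed y))\<^sup>2"]
    by (simp add: partial_deriv_embed[OF diff] normal harmonic_morphism_def)
  ultimately show ?thesis
    using smooth_on_precompose_bounded_linear[OF bounded_linear_embed smooth]
    by (simp add: harmonic_morphism_def harmonic_map_def)
qed

end

section \<open>A Hermitian structure varying holomorphically with one coordinate\<close>

locale complex_coordinates =
  fixes h :: "'m::finite \<times> bool \<Rightarrow> 'n::finite"
  assumes bij_h: "bij h"
begin

definition cc :: "'m \<Rightarrow> real^'n \<Rightarrow> complex" where
  "cc j x = Complex (x $ h (j, False)) (x $ h (j, True))"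

definition vec_of :: "complex^'m \<Rightarrow> real^'n" where
  "vec_of w = (\<chi> i. case inv h i of (j, t) \<Rightarrow> if t then Im (w $ j) else Re (w $ j))"

lemma h_eq_iff [simp]: "h p = h q \<longleftrightarrow> p = q"
  using bij_h by (simp add: bij_is_inj inj_eq)

lemma cc_vec_of [simp]: "cc j (vec_of w) = w $ j"
  using bij_h by (simp add: cc_def vec_of_def bij_def complex_eq_iff)

lemma cc_eqI:
  assumes "\<And>j. cc j x = cc j y"
  shows "x = y"
  unfolding vec_eq_iff
proof
  fix i
  obtain j t where i: "i = h (j, t)" using bij_h by (metis bij_pointE surj_pair)
  show "x $ i = y $ i"
    using assms[of j] by (cases t) (simp_all add: i cc_def)
qed

lemma vec_of_cc [simp]: "vec_of (\<chi> j. cc j x) = x"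
  by (rule cc_eqI) simp

lemma bounded_linear_cc: "bounded_linear (cc j)"
  unfolding linear_conv_bounded_linear[symmetric]
  by (rule linearI) (auto simp: cc_def complex_eq_iff)

lemma bounded_linear_vec_of: "bounded_linear vec_of"
  unfolding linear_conv_bounded_linear[symmetric]
  by (rule linearI) (auto simp: vec_of_def vec_eq_iff split: prod.split)

lemma cc_0 [simp]: "cc j 0 = 0"
  by (simp add: cc_def complex_eq_iff)

lemma cc_axis:
  "cc i (axis (h (j, False)) 1) = (if i = j then 1 else 0)"
  "cc i (axis (h (j, True)) 1) = (if i = j then \<i> else 0)"
  by (auto simp: cc_def axis_def complex_eq_iff)

lemma sum_coordinates:
  "(\<Sum>i\<in>UNIV. g i) = (\<Sum>j\<in>UNIV. g (h (j, False)) + g (h (j, True)))"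
proof -
  have "(\<Sum>i\<in>UNIV. g i) = (\<Sum>p\<in>UNIV. g (h p))"
    by (rule sum.reindex_bij_betw[symmetric]) (use bij_h in \<open>simp add: bij_betw_def bij_def\<close>)
  also have "\<dots> = (\<Sum>j\<in>UNIV. \<Sum>t\<in>UNIV. g (h (j, t)))"
    by (simp add: sum.cartesian_product UNIV_Times_UNIV)
  finally show ?thesis by (simp add: UNIV_bool add.commute)
qed

lemma norm_cc: "norm x = sqrt (\<Sum>j\<in>UNIV. (cmod (cc j x))\<^sup>2)"
  by (simp add: norm_vec_def L2_set_def sum_coordinates[of "\<lambda>i. (x $ i)\<^sup>2"] cmod_power2 cc_def)

lemma has_derivative_cc [derivative_intros]:
  "(g has_derivative g') F \<Longrightarrow> ((\<lambda>x. cc j (g x)) has_derivative (\<lambda>x. cc j (g' x))) F"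
  by (rule bounded_linear.has_derivative[OF bounded_linear_cc])

lemma smooth_on_cc [smooth_intros]: "open S \<Longrightarrow> smooth_on S (cc j)"
  by (rule smooth_on_bounded_linear[OF _ bounded_linear_cc])

end

text \<open>This is the denominator 1 + |z|^2 of \<open>J\<close> and of \<open>chart_inv\<close>;
  its nonvanishing lets both be smooth on the whole space.\<close>

lemma one_plus_norm_nonzero: "1 + z * cnj z \<noteq> 0"
proof -
  have "1 + z * cnj z = of_real (1 + (cmod z)\<^sup>2)"
    by (simp only: of_real_add of_real_1 complex_norm_square)
  moreover have "1 + (cmod z)\<^sup>2 \<noteq> 0" by (simp add: add_nonneg_eq_0_iff)
  ultimately show ?thesis by (simp only: of_real_eq_0_iff not_False_eq_True)
qed

locale twisted_coordinates = complex_coordinates h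
  for h :: "'m::finite \<times> bool \<Rightarrow> 'n::finite" +
  fixes a b c :: 'm
  assumes distinct: "a \<noteq> b" "a \<noteq> c" "b \<noteq> c"
begin

lemmas neq = distinct distinct[symmetric]

lemma sum_split: "(\<Sum>j\<in>UNIV. g j) = g a + g b + (\<Sum>j\<in>- {a, b}. g j)"
proof -
  have "UNIV = insert a (insert b (- {a, b}))" by auto
  then have "(\<Sum>j\<in>UNIV. g j) = sum g (insert a (insert b (- {a, b})))" by simp
  then show ?thesis using distinct by (simp add: add.assoc)
qed

section \<open>The harmonic morphism \<open>phi\<close>\<close>

definition phi :: "real^'n \<Rightarrow> complex" where
  "phi x = cc b x + (cc c x)\<^sup>2 * cnj (cc b x) - cc c x * (cc a x - cnj (cc a x)) +
    (\<Sum>j\<in>- {a, b}. (cc j x)\<^sup>2)"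

definition dphi :: "real^'n \<Rightarrow> real^'n \<Rightarrow> complex" where
  "dphi x v = cc b v + 2 * cc c x * cc c v * cnj (cc b x) + (cc c x)\<^sup>2 * cnj (cc b v)
    - cc c v * (cc a x - cnj (cc a x)) - cc c x * (cc a v - cnj (cc a v)) +
    (\<Sum>j\<in>- {a, b}. 2 * cc j x * cc j v)"

text \<open>Only the diagonal of the Hessian is recorded, which is all that the Laplacian
  involves.\<close>

definition d2phi :: "real^'n \<Rightarrow> real^'n \<Rightarrow> complex" where
  "d2phi x v = 2 * (cc c v)\<^sup>2 * cnj (cc b x) + 4 * cc c x * cc c v * cnj (cc b v)
    - 2 * cc c v * (cc a v - cnj (cc a v)) + (\<Sum>j\<in>- {a, b}. 2 * (cc j v)\<^sup>2)"

lemma has_derivative_phi: "(phi has_derivative dphi x) (at x)"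
  unfolding phi_def[abs_def] dphi_def[abs_def]
  by (rule has_derivative_eq_rhs, (rule derivative_intros)+)
    (auto simp: fun_eq_iff algebra_simps power2_eq_square)

lemma frechet_derivative_phi [simp]: "frechet_derivative phi (at x) = dphi x"
  by (rule frechet_derivative_eq[OF has_derivative_phi])

lemma frechet_derivative_dphi: "frechet_derivative (\<lambda>x. dphi x v) (at x) v = d2phi x v"
proof -
  have "((\<lambda>x. dphi x v) has_derivative (\<lambda>w. 2 * cc c w * cc c v * cnj (cc b x) +
      2 * cc c x * cc c v * cnj (cc b w) + 2 * cc c x * cc c w * cnj (cc b v)
      - cc c v * (cc a w - cnj (cc a w)) - cc c w * (cc a v - cnj (cc a v)) +
      (\<Sum>j\<in>- {a, b}. 2 * cc j w * cc j v))) (at x)"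
    unfolding dphi_def[abs_def]
    by (rule has_derivative_eq_rhs, (rule derivative_intros)+)
      (auto simp: fun_eq_iff algebra_simps power2_eq_square)
  then show ?thesis
    by (simp add: frechet_derivative_eq d2phi_def power2_eq_square algebra_simps)
qed

lemma smooth_phi: "smooth_on UNIV phi"
  unfolding phi_def[abs_def] by (intro smooth_intros open_UNIV)

text \<open>No monomial of \<open>phi\<close> contains both q_j and cnj q_j for the same j, so the
  second derivatives along the real and imaginary parts of q_j cancel.\<close>

lemma phi_laplacian: "(\<Sum>i\<in>UNIV. partial_deriv i (partial_deriv i phi) x) = 0"
proof -
  have p: "partial_deriv i phi = (\<lambda>x. dphi x (axis i 1))" for i
    by (simp add: partial_deriv_def fun_eq_iff)
  have "partial_deriv i (partial_deriv i phi) x = d2phi x (axis i 1)" for i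
    unfolding p by (simp add: partial_deriv_def frechet_derivative_dphi)
  moreover have "d2phi x (axis (h (j, True)) 1) = - d2phi x (axis (h (j, False)) 1)" for j
  proof -
    define S where "S = (\<Sum>i\<in>- {a, b}. 2 * (cc i (axis (h (j, False)) 1))\<^sup>2)"
    have S: "(\<Sum>i\<in>- {a, b}. 2 * (cc i (axis (h (j, True)) 1))\<^sup>2) = - S"
      unfolding sum_negf[symmetric] S_def by (intro sum.cong refl) (simp add: cc_axis)
    then show ?thesis
      using neq unfolding d2phi_def S S_def[symmetric] by (auto simp: cc_axis)
  qed
  ultimately show ?thesis
    by (simp add: sum_coordinates[of "\<lambda>i. d2phi x (axis i 1)"])
qed

text \<open>In complex coordinates the sum of squares is 4 times the sum of the products of the
  derivatives by q_j and cnj q_j. Only j = a and j = b contribute, with products -z^2 and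
  z^2.\<close>

lemma phi_isotropic: "(\<Sum>i\<in>UNIV. (partial_deriv i phi x)\<^sup>2) = 0"
proof -
  \<comment> \<open>\<open>P j\<close> and \<open>Q j\<close> are the Wirtinger derivatives of
    \<open>phi\<close> by q_j and cnj q_j at \<open>x\<close>.\<close>
  define P where "P j = (if j = a then - cc c x else if j = b then 1 else 2 * cc j x +
    (if j = c then 2 * cc c x * cnj (cc b x) - (cc a x - cnj (cc a x)) else 0))" for j
  define Q where "Q j = (if j = a then cc c x else if j = b then (cc c x)\<^sup>2 else 0)" for j
  have s: "(\<Sum>i\<in>- {a, b}. 2 * cc i x * (if i = j then u else 0)) =
      (if j = a \<or> j = b then 0 else 2 * cc j x * u)" for j u
    by (simp add: if_distrib[of "\<lambda>u. _ * u"] sum.delta cong: if_cong)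
  note axis = dphi_def cc_axis s P_def Q_def
  have "dphi x (axis (h (j, False)) 1) = P j + Q j" for j
    unfolding axis using neq by auto
  moreover have "dphi x (axis (h (j, True)) 1) = \<i> * (P j - Q j)" for j
    unfolding axis using neq by (auto simp: algebra_simps)
  moreover have "(P j + Q j)\<^sup>2 + (\<i> * (P j - Q j))\<^sup>2 = 4 * P j * Q j" for j
    by (simp add: power_mult_distrib) (simp add: power2_eq_square algebra_simps)
  ultimately have "(\<Sum>i\<in>UNIV. (partial_deriv i phi x)\<^sup>2) = (\<Sum>j\<in>UNIV. 4 * P j * Q j)"
    by (simp only: partial_deriv_def frechet_derivative_phi sum_coordinates[of "\<lambda>i. (dphi x (axis i 1))\<^sup>2"])
  also have "\<dots> = 0"
    unfolding sum_split using neq by (simp add: P_def Q_def power2_eq_square)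
  finally show ?thesis .
qed

lemma harmonic_morphism_phi: "harmonic_morphism phi"
  by (simp add: harmonic_morphism_def harmonic_map_def smooth_phi phi_laplacian phi_isotropic)

section \<open>The almost Hermitian structure \<open>J\<close>\<close>

definition J :: "real^'n \<Rightarrow> real^'n \<Rightarrow> real^'n" where
  "J x v = vec_of (\<chi> j. let z = cc c x in
     if j = a then \<i> * ((1 - z * cnj z) * cc a v - 2 * z * cnj (cc b v)) / (1 + z * cnj z)
     else if j = b then \<i> * ((1 - z * cnj z) * cc b v + 2 * z * cnj (cc a v)) / (1 + z * cnj z)
     else \<i> * cc j v)"

text \<open>The first two values are the solution of the equations in \<open>J_forms\<close> below,
  which ask that \<open>J x\<close> act as \<open>\<i>\<close> on the two twisted forms; at z = 0
  they reduce to multiplication by \<open>\<i>\<close>.\<close>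

lemma cc_J:
  "cc a (J x v) = \<i> * ((1 - cc c x * cnj (cc c x)) * cc a v - 2 * cc c x * cnj (cc b v))
    / (1 + cc c x * cnj (cc c x))"
  "cc b (J x v) = \<i> * ((1 - cc c x * cnj (cc c x)) * cc b v + 2 * cc c x * cnj (cc a v))
    / (1 + cc c x * cnj (cc c x))"
  "j \<noteq> a \<Longrightarrow> j \<noteq> b \<Longrightarrow> cc j (J x v) = \<i> * cc j v"
  using neq by (simp_all add: neq J_def Let_def)

text \<open>The \<open>(1,0)\<close>-forms of the structure are \<open>dq_j\<close> for \<open>j \<notin> {a, b}\<close> together with
  the following two, with \<open>z = q_c\<close>.\<close>

lemma J_forms:
  "cc a (J x v) - cc c x * cnj (cc b (J x v)) = \<i> * (cc a v - cc c x * cnj (cc b v))"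
  "cc b (J x v) + cc c x * cnj (cc a (J x v)) = \<i> * (cc b v + cc c x * cnj (cc a v))"
  using one_plus_norm_nonzero[of "cc c x"]
  by (simp_all add: neq cc_J divide_simps mult.commute[of "cnj (cc c x)"])
    (simp_all add: neq algebra_simps)

text \<open>The values p - z cnj q and q + z cnj p determine p and q up to the nonzero factor 1 +
  |z|^2. Hence vectors can be compared through the forms, on which \<open>J\<close> is just
  multiplication by \<open>\<i>\<close>.\<close>

lemma J_unique:
  assumes "cc a u - cc c x * cnj (cc b u) = cc a v - cc c x * cnj (cc b v)"
    and "cc b u + cc c x * cnj (cc a u) = cc b v + cc c x * cnj (cc a v)"
    and "\<And>j. j \<noteq> a \<Longrightarrow> j \<noteq> b \<Longrightarrow> cc j u = cc j v"
  shows "u = v"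
proof (rule cc_eqI)
  let ?z = "cc c x"
  have inv: "(1 + ?z * cnj ?z) * p = (p - ?z * cnj q) + ?z * cnj (q + ?z * cnj p)"
    "(1 + ?z * cnj ?z) * q = (q + ?z * cnj p) - ?z * cnj (p - ?z * cnj q)" for p q
    by (simp_all add: neq algebra_simps)
  have "(1 + ?z * cnj ?z) * cc a u = (1 + ?z * cnj ?z) * cc a v"
    "(1 + ?z * cnj ?z) * cc b u = (1 + ?z * cnj ?z) * cc b v"
    by (simp_all only: inv(1)[of "cc a u" "cc b u"] inv(1)[of "cc a v" "cc b v"]
        inv(2)[of "cc b u" "cc a u"] inv(2)[of "cc b v" "cc a v"] assms(1,2))
  then show "cc j u = cc j v" for j
    using assms(3)[of j] one_plus_norm_nonzero[of ?z] by (cases "j = a"; cases "j = b") auto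
qed

lemma J_J: "J x (J x v) = - v"
proof (rule J_unique[of _ x])
  have m: "cc j (- v) = - cc j v" for j by (simp add: cc_def complex_eq_iff)
  show "cc a (J x (J x v)) - cc c x * cnj (cc b (J x (J x v))) =
      cc a (- v) - cc c x * cnj (cc b (- v))"
    by (simp only: J_forms m) (simp add: algebra_simps)
  show "cc b (J x (J x v)) + cc c x * cnj (cc a (J x (J x v))) =
      cc b (- v) + cc c x * cnj (cc a (- v))"
    by (simp only: J_forms m) (simp add: algebra_simps)
  show "cc j (J x (J x v)) = cc j (- v)" if "j \<noteq> a" "j \<noteq> b" for j
    using that by (simp add: cc_J m)
qed

lemma linear_J: "linear (J x)"
proof (rule linearI; rule cc_eqI)
  fix u v and r :: real and j
  have add: "cc j (u + v) = cc j u + cc j v" for j u v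
    by (rule linear_add[OF bounded_linear.linear[OF bounded_linear_cc]])
  have scale: "cc j (r *\<^sub>R u) = of_real r * cc j u" for j u
    by (rule trans[OF linear_cmul[OF bounded_linear.linear[OF bounded_linear_cc]] scaleR_conv_of_real])
  show "cc j (J x (u + v)) = cc j (J x u + J x v)"
    by (cases "j = a"; cases "j = b")
      (simp_all add: neq cc_J add add_divide_distrib[symmetric] algebra_simps)
  show "cc j (J x (r *\<^sub>R u)) = cc j (r *\<^sub>R J x u)"
    by (cases "j = a"; cases "j = b") (simp_all add: neq cc_J scale algebra_simps)
qed

text \<open>For fixed \<open>z\<close> the map \<open>(p, q) \<mapsto> (p - z cnj q, q + z cnj p)\<close> is conformal with
  factor \<open>1 + |z|^2\<close>, so the structure is orthogonal.\<close>

lemma conformal: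
  "(cmod (p - z * cnj q))\<^sup>2 + (cmod (q + z * cnj p))\<^sup>2 =
    (1 + (cmod z)\<^sup>2) * ((cmod p)\<^sup>2 + (cmod q)\<^sup>2)"
  by (simp add: cmod_power2) (simp add: power2_eq_square algebra_simps)

lemma norm_J: "norm (J x v) = norm v"
proof -
  let ?n = "\<lambda>w. (cmod w)\<^sup>2" and ?z = "cc c x"
  \<comment> \<open>By \<open>conformal\<close> both sides are sums of squared moduli of the two
    twisted forms, and multiplication by \<open>\<i>\<close> preserves these moduli.\<close>
  have "(1 + ?n ?z) * (?n (cc a (J x v)) + ?n (cc b (J x v))) =
      (1 + ?n ?z) * (?n (cc a v) + ?n (cc b v))"
    unfolding conformal[symmetric] J_forms by (simp add: norm_mult)
  moreover have "1 + ?n ?z \<noteq> 0" by (simp add: add_nonneg_eq_0_iff)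
  ultimately have "?n (cc a (J x v)) + ?n (cc b (J x v)) = ?n (cc a v) + ?n (cc b v)"
    by (simp only: mult_cancel_left) simp
  moreover have "(\<Sum>j\<in>- {a, b}. ?n (cc j (J x v))) = (\<Sum>j\<in>- {a, b}. ?n (cc j v))"
    by (intro sum.cong refl) (auto simp: cc_J norm_mult)
  ultimately show ?thesis
    by (simp add: norm_cc sum_split[of "\<lambda>j. ?n (cc j v)"] sum_split[of "\<lambda>j. ?n (cc j (J x v))"])
qed

lemma almost_hermitian_J: "almost_hermitian_structure J"
  unfolding almost_hermitian_structure_def
proof (intro conjI allI)
  show "orthogonal_transformation (J x)" for x
    by (simp add: orthogonal_transformation linear_J norm_J)
  show "J x (J x v) = - v" for x v by (rule J_J)
  fix v
  have "smooth_on UNIV (\<lambda>x. \<chi> j. cc j (J x v))"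
  proof (rule smooth_on_vec, rule open_UNIV)
    fix j
    have "smooth_on UNIV (\<lambda>x. cc j (J x v))"
    proof (cases "j = a \<or> j = b")
      case True
      then show ?thesis
        by (auto simp only: cc_J intro!: smooth_intros open_UNIV one_plus_norm_nonzero)
    next
      case False
      then show ?thesis by (simp add: cc_J smooth_on_const)
    qed
    then show "smooth_on UNIV (\<lambda>x. (\<chi> j. cc j (J x v)) $ j)" by simp
  qed
  from smooth_on_compose_bounded_linear[OF bounded_linear_vec_of this]
  show "smooth_on UNIV (\<lambda>x. J x v)" by simp
qed

section \<open>A global holomorphic chart for \<open>J\<close>\<close>

definition chart :: "real^'n \<Rightarrow> complex^'m" where
  "chart x = (\<chi> j. if j = a then cc a x - cc c x * cnj (cc b x)
     else if j = b then cc b x + cc c x * cnj (cc a x) else cc j x)"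

definition dchart :: "real^'n \<Rightarrow> real^'n \<Rightarrow> complex^'m" where
  "dchart x v = (\<chi> j.
     if j = a then cc a v - cc c x * cnj (cc b v) - cc c v * cnj (cc b x)
     else if j = b then cc b v + cc c x * cnj (cc a v) + cc c v * cnj (cc a x) else cc j v)"

text \<open>For fixed z = w_c the first two components of \<open>chart\<close> form an invertible
  real-linear system in q_a and q_b, solved here as in \<open>J_unique\<close>.\<close>

definition chart_inv :: "complex^'m \<Rightarrow> real^'n" where
  "chart_inv w = vec_of (\<chi> j.
     if j = a then (w $ a + w $ c * cnj (w $ b)) / (1 + w $ c * cnj (w $ c))
     else if j = b then (w $ b - w $ c * cnj (w $ a)) / (1 + w $ c * cnj (w $ c)) else w $ j)"

lemma has_derivative_chart: "(chart has_derivative dchart x) (at x)"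
  unfolding chart_def[abs_def] dchart_def[abs_def]
proof (rule has_derivative_vec_lambda)
  have "((\<lambda>x. cc a x - cc c x * cnj (cc b x)) has_derivative
      (\<lambda>v. cc a v - cc c x * cnj (cc b v) - cc c v * cnj (cc b x))) (at x)"
    "((\<lambda>x. cc b x + cc c x * cnj (cc a x)) has_derivative
      (\<lambda>v. cc b v + cc c x * cnj (cc a v) + cc c v * cnj (cc a x))) (at x)"
    by (rule has_derivative_eq_rhs, (rule derivative_intros)+, simp add: fun_eq_iff algebra_simps)+
  then show "((\<lambda>x. if j = a then cc a x - cc c x * cnj (cc b x)
      else if j = b then cc b x + cc c x * cnj (cc a x) else cc j x) has_derivative
      (\<lambda>v. if j = a then cc a v - cc c x * cnj (cc b v) - cc c v * cnj (cc b x)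
      else if j = b then cc b v + cc c x * cnj (cc a v) + cc c v * cnj (cc a x) else cc j v)) (at x)"
    for j
    by (cases "j = a"; cases "j = b") (simp_all add: neq has_derivative_cc[OF has_derivative_ident])
qed

lemma smooth_chart: "smooth_on UNIV chart"
proof (rule smooth_on_vec, rule open_UNIV)
  fix j
  have "smooth_on UNIV (\<lambda>x. cc a x - cc c x * cnj (cc b x))"
    "smooth_on UNIV (\<lambda>x. cc b x + cc c x * cnj (cc a x))"
    by (intro smooth_intros open_UNIV)+
  then show "smooth_on UNIV (\<lambda>x. chart x $ j)"
    by (cases "j = a"; cases "j = b") (simp_all add: neq chart_def smooth_on_cc)
qed

lemma smooth_chart_inv: "smooth_on UNIV chart_inv"
  unfolding chart_inv_def[abs_def]
proof (rule smooth_on_compose_bounded_linear[OF bounded_linear_vec_of smooth_on_vec[OF open_UNIV]])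
  fix j
  have nth [smooth_intros]: "smooth_on UNIV (\<lambda>w::complex^'m. w $ j)" for j
    by (rule smooth_on_bounded_linear[OF open_UNIV bounded_linear_vec_nth])
  have "smooth_on UNIV (\<lambda>w::complex^'m. (w $ a + w $ c * cnj (w $ b)) / (1 + w $ c * cnj (w $ c)))"
    "smooth_on UNIV (\<lambda>w::complex^'m. (w $ b - w $ c * cnj (w $ a)) / (1 + w $ c * cnj (w $ c)))"
    by (intro smooth_intros open_UNIV one_plus_norm_nonzero)+
  then show "smooth_on UNIV (\<lambda>w::complex^'m. (\<chi> j.
     if j = a then (w $ a + w $ c * cnj (w $ b)) / (1 + w $ c * cnj (w $ c))
     else if j = b then (w $ b - w $ c * cnj (w $ a)) / (1 + w $ c * cnj (w $ c)) else w $ j) $ j)"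
    by (cases "j = a"; cases "j = b") (simp_all add: neq nth)
qed

lemma chart_inv_chart: "chart_inv (chart x) = x"
proof (rule cc_eqI)
  fix j
  show "cc j (chart_inv (chart x)) = cc j x"
    using neq one_plus_norm_nonzero[of "cc c x"]
    by (simp add: chart_inv_def chart_def divide_simps) (auto simp: algebra_simps)
qed

lemma chart_chart_inv: "chart (chart_inv w) = w"
  unfolding vec_eq_iff
proof
  fix j
  show "chart (chart_inv w) $ j = w $ j"
    using neq one_plus_norm_nonzero[of "w $ c"]
    by (simp add: chart_inv_def chart_def divide_simps mult.commute[of "cnj (w $ c)"])
      (auto simp: algebra_simps)
qed

lemma hermitian_J: "hermitian_structure TYPE('m) J"
proof -
  have "continuous_on UNIV chart" "continuous_on UNIV chart_inv"
    using smooth_chart smooth_chart_inv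
    by (auto simp: smooth_on_def dest: spec[of _ 0])
  then have "homeomorphism UNIV UNIV chart chart_inv"
    by (intro homeomorphismI) (simp_all add: neq chart_inv_chart chart_chart_inv)
  then have "diffeomorphism UNIV UNIV chart chart_inv"
    by (simp add: diffeomorphism_def smooth_chart smooth_chart_inv)
  \<comment> \<open>Differentiating the chart adds only multiples of dz to the two twisted forms,
    and dz is itself of type (1,0). This is where holomorphic dependence on z yields
    integrability.\<close>
  moreover have "frechet_derivative chart (at y) (J y v) = \<i> *s frechet_derivative chart (at y) v" for y v
    unfolding frechet_derivative_eq[OF has_derivative_chart]
    using neq by (auto simp: vec_eq_iff dchart_def J_forms cc_J(3) right_diff_distrib distrib_left)
  ultimately show ?thesis
    unfolding hermitian_structure_def using almost_hermitian_J by blast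
qed

lemma holomorphic_phi: "holomorphic_wrt J phi"
  unfolding holomorphic_wrt_def
proof (intro allI conjI)
  fix x v
  show "phi differentiable at x" using has_derivative_phi by (rule differentiableI)
  \<comment> \<open>The differential is regrouped as a combination of (1,0)-forms, with coefficients
    that depend on \<open>x\<close> only.\<close>
  have d: "dphi x v = (cc b v + cc c x * cnj (cc a v)) - cc c x * (cc a v - cc c x * cnj (cc b v)) +
      cc c v * (2 * cc c x * cnj (cc b x) - (cc a x - cnj (cc a x))) +
      (\<Sum>j\<in>- {a, b}. 2 * cc j x * cc j v)" for v
    by (simp add: dphi_def algebra_simps power2_eq_square)
  have "(\<Sum>j\<in>- {a, b}. 2 * cc j x * cc j (J x v)) = \<i> * (\<Sum>j\<in>- {a, b}. 2 * cc j x * cc j v)"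
    unfolding sum_distrib_left by (intro sum.cong refl) (auto simp: cc_J)
  moreover have "cc c (J x v) = \<i> * cc c v" using neq by (simp add: cc_J)
  ultimately show "frechet_derivative phi (at x) (J x v) = \<i> * frechet_derivative phi (at x) v"
    by (simp only: frechet_derivative_phi d J_forms) (simp only: algebra_simps)
qed

section \<open>The differentials of \<open>phi\<close> at selected points\<close>

lemma dphi_vec_of:
  "dphi (vec_of w) v = cc b v + 2 * w $ c * cc c v * cnj (w $ b) + (w $ c)\<^sup>2 * cnj (cc b v)
    - cc c v * (w $ a - cnj (w $ a)) - w $ c * (cc a v - cnj (cc a v)) +
    (\<Sum>j\<in>- {a, b}. 2 * w $ j * cc j v)"
  by (simp add: dphi_def)

lemma sum_axis: "j \<noteq> a \<Longrightarrow> j \<noteq> b \<Longrightarrow>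
  (\<Sum>i\<in>- {a, b}. 2 * (axis j t :: complex^'m) $ i * g i) = 2 * t * g j"
proof -
  assume j: "j \<noteq> a" "j \<noteq> b"
  have "(\<Sum>i\<in>- {a, b}. 2 * (axis j t :: complex^'m) $ i * g i) =
      (\<Sum>i\<in>- {a, b}. if i = j then 2 * t * g j else 0)"
    by (intro sum.cong refl) (simp add: axis_def)
  then show ?thesis using j by (simp add: sum.delta)
qed

lemma dphi_axis_c: "dphi (vec_of (axis c t)) v =
    cc b v + t\<^sup>2 * cnj (cc b v) - t * (cc a v - cnj (cc a v)) + 2 * t * cc c v"
  using neq by (simp add: dphi_vec_of sum_axis) (simp add: axis_def)

lemma dphi_0: "dphi 0 v = cc b v"
  by (simp add: dphi_def)

text \<open>If a constant \<open>K\<close> worked, every sum of differentials at different points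
  would turn \<open>K\<close> into multiplication by \<open>\<i>\<close>. The differentials at z = 1
  and z = -1, with all other coordinates 0, add up to 4 Re q_b, which is real valued and nonzero: a
  contradiction.\<close>

lemma not_kaehler:
  assumes "kaehler_structure K"
  shows "\<not> holomorphic_wrt K phi"
proof
  assume "holomorphic_wrt K phi"
  then have "dphi x (K x v) = \<i> * dphi x v" for x v by (simp add: holomorphic_wrt_def)
  moreover have "K x = K 0" for x using assms by (simp add: kaehler_structure_def)
  ultimately have hol: "dphi x (K 0 v) = \<i> * dphi x v" for x v by metis
  define v where "v = axis (h (b, False)) (1::real)"
  let ?u = "K 0 v"
  have b: "cc b v = 1" by (simp add: v_def cc_axis)
  have u: "cc b ?u = \<i>" using hol[of 0 v] by (simp add: dphi_0 b)
  have "dphi (vec_of (axis c 1)) w + dphi (vec_of (axis c (- 1))) w =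
      2 * (cc b w + cnj (cc b w))" for w
    by (simp add: dphi_axis_c)
  from this[of ?u] this[of v] show False
    by (simp add: hol u b distrib_left[symmetric])
qed

text \<open>Chosen base points isolate the coordinates of \<open>u\<close> one by one. Only the real
  part of q_a is invisible to all differentials, and the second hypothesis excludes it.\<close>

lemma dphi_nondegenerate:
  assumes zero: "\<And>x. dphi x u = 0" and re: "Re (cc a u) = 0"
  shows "u = 0"
proof (rule cc_eqI)
  have b: "cc b u = 0" using zero[of 0] by (simp add: dphi_0)
  \<comment> \<open>This is what the squares in \<open>phi\<close> provide: the coordinates q_j with
    j outside {a, b, c} enter \<open>phi\<close> through them alone.\<close>
  have other: "cc j u = 0" if j: "j \<noteq> a" "j \<noteq> b" "j \<noteq> c" for j
    using zero[of "vec_of (axis j 1)"] j neq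
    by (simp add: dphi_vec_of sum_axis b) (simp add: axis_def)
  have c1: "- (cc a u - cnj (cc a u)) + 2 * cc c u = 0"
    using zero[of "vec_of (axis c 1)"] by (simp add: dphi_axis_c b)
  \<comment> \<open>Adding \<open>axis b 1\<close> to the base point leaves this sum alone, since b
    is omitted from it. The differential changes only in the term 2 z cnj(q_b) dz, so comparison
    with \<open>c1\<close> isolates \<open>cc c u\<close>.\<close>
  have "(\<Sum>j\<in>- {a, b}. 2 * (axis c 1 + axis b 1 :: complex^'m) $ j * cc j u) =
      (\<Sum>j\<in>- {a, b}. 2 * (axis c 1 :: complex^'m) $ j * cc j u)"
    by (intro sum.cong refl) (auto simp: axis_def)
  also have "\<dots> = 2 * cc c u" using sum_axis[of c 1] neq by simp
  finally have sum: "(\<Sum>j\<in>- {a, b}. 2 * (axis c 1 + axis b 1 :: complex^'m) $ j * cc j u) = 2 * cc c u" .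
  have "2 * cc c u - (cc a u - cnj (cc a u)) + 2 * cc c u = 0"
    using zero[of "vec_of (axis c 1 + axis b 1)"] neq unfolding dphi_vec_of sum b
    by (simp add: axis_def)
  with c1 have c: "cc c u = 0" by (simp add: algebra_simps)
  with c1 have "cc a u - cnj (cc a u) = 0" by simp
  with re have "cc a u = 0" by (simp add: complex_eq_iff)
  with b c other show "cc j u = cc j 0" for j by (cases "j = a \<or> j = b \<or> j = c") auto
qed

end

section \<open>Descent to the hyperplane\<close>

locale twisted_projection = twisted_coordinates h a b c + coordinate_hyperplane e "h (a, False)"
  for h :: "'m::finite \<times> bool \<Rightarrow> 'n::finite" and a b c and e :: "'k::finite \<Rightarrow> 'n"
begin

lemma embed_restr_nth: "i \<noteq> h (a, False) \<Longrightarrow> embed (restr x) $ i = x $ i"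
  by (simp add: embed_def e_inv)

lemma cc_embed_restr:
  "j \<noteq> a \<Longrightarrow> cc j (embed (restr x)) = cc j x"
  "cc a (embed (restr x)) - cnj (cc a (embed (restr x))) = cc a x - cnj (cc a x)"
  by (simp_all add: cc_def embed_restr_nth complex_eq_iff)

lemma phi_embed_restr: "phi (embed (restr x)) = phi x"
proof -
  have "(\<Sum>j\<in>- {a, b}. (cc j (embed (restr x)))\<^sup>2) = (\<Sum>j\<in>- {a, b}. (cc j x)\<^sup>2)"
    by (intro sum.cong refl) (auto simp: cc_embed_restr)
  then show ?thesis using neq by (simp add: phi_def cc_embed_restr)
qed

text \<open>Points of the hyperplane already give all differentials of \<open>phi\<close>, so
  \<open>dphi_nondegenerate\<close>, which quantifies over the whole space, applies to
  \<open>psi\<close>.\<close>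

lemma dphi_embed_restr: "dphi (embed (restr x)) v = dphi x v"
proof -
  have "(\<Sum>j\<in>- {a, b}. 2 * cc j (embed (restr x)) * cc j v) = (\<Sum>j\<in>- {a, b}. 2 * cc j x * cc j v)"
    by (intro sum.cong refl) (auto simp: cc_embed_restr)
  then show ?thesis using neq by (simp add: dphi_def cc_embed_restr)
qed

definition psi :: "real^'k \<Rightarrow> complex" where
  "psi y = phi (embed y)"

lemma has_derivative_psi: "(psi has_derivative (\<lambda>v. dphi (embed y) (embed v))) (at y)"
  using has_derivative_embed[OF differentiableI[OF has_derivative_phi], of y]
  by (simp add: psi_def[abs_def])

lemma factors_to_psi: "factors_to phi psi"
  unfolding psi_def[abs_def] by (rule factors_to_embed) (rule phi_embed_restr)

lemma harmonic_morphism_psi: "harmonic_morphism psi"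
  unfolding psi_def[abs_def]
  by (rule harmonic_morphism_embed[OF harmonic_morphism_phi]) (rule phi_embed_restr)

lemma full_psi: "full psi"
proof (rule fullI)
  show "psi differentiable at y" for y using has_derivative_psi by (rule differentiableI)
  fix u
  assume "\<And>y. frechet_derivative psi (at y) u = 0"
  then have "dphi (embed (restr x)) (embed u) = 0" for x
    by (simp add: frechet_derivative_eq[OF has_derivative_psi])
  then have "embed u = 0"
    by (intro dphi_nondegenerate) (simp_all add: dphi_embed_restr cc_def)
  then have "embed u $ e k = 0" for k by simp
  then show "u = 0" by (simp add: vec_eq_iff)
qed

text \<open>Along the real and imaginary parts of q_b the differential takes the values 1 + z^2 and
  i (1 - z^2), which never vanish together.\<close>

lemma submersion_psi: "submersion psi"
proof (rule harmonic_morphism_imp_submersion[OF harmonic_morphism_psi])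
  fix y
  define z where "z = cc c (embed y)"
  have sum: "(\<Sum>j\<in>- {a, b}. 2 * cc j x * (if j = b then t else 0)) = 0" for x t
    by (intro sum.neutral) auto
  have "dphi (embed y) (axis (h (b, False)) 1) = 1 + z\<^sup>2"
    "dphi (embed y) (axis (h (b, True)) 1) = \<i> * (1 - z\<^sup>2)"
    unfolding dphi_def cc_axis sum z_def using neq by (auto simp: algebra_simps)
  moreover have "1 + z\<^sup>2 \<noteq> 0 \<or> \<i> * (1 - z\<^sup>2) \<noteq> 0"
    by (auto simp: eq_neg_iff_add_eq_0[symmetric])
  \<comment> \<open>Both test directions lie in the hyperplane, so they are available as directions
    for \<open>psi\<close>.\<close>
  moreover have "axis (h (b, t)) 1 = embed (restr (axis (h (b, t)) 1))" for t
    using neq by (intro embed_restr[symmetric]) (auto simp: axis_def)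
  ultimately show "\<exists>v. frechet_derivative psi (at y) v \<noteq> 0"
    unfolding frechet_derivative_eq[OF has_derivative_psi] by metis
qed

end

theorem theorem4p20:
  fixes m :: nat
  assumes "m > 2"
    and "CARD('m::finite) = m"
    and "CARD('n::finite) = 2 * m"
    and "CARD('k::finite) = 2 * m - 1"
  shows "\<exists>(\<phi> :: real^'n \<Rightarrow> complex) (J :: real^'n \<Rightarrow> real^'n \<Rightarrow> real^'n) (\<psi> :: real^'k \<Rightarrow> complex).
    harmonic_map \<phi> \<and>
    hermitian_structure TYPE('m) J \<and> holomorphic_wrt J \<phi> \<and>
    (\<forall>K. kaehler_structure K \<longrightarrow> \<not> holomorphic_wrt K \<phi>) \<and>
    factors_to \<phi> \<psi> \<and> full \<psi> \<and> harmonic_morphism \<psi> \<and> submersion \<psi>"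
proof -
  \<comment> \<open>The 2m real coordinates are paired into m complex ones; the Boolean
    distinguishes real and imaginary parts.\<close>
  obtain h :: "'m \<times> bool \<Rightarrow> 'n" where h: "bij h"
    using finite_same_card_bij[of "UNIV :: ('m \<times> bool) set" "UNIV :: 'n set"] assms(2,3) by auto
  \<comment> \<open>The assumption m > 2 provides the three distinct indices: two for the twisted
    plane and one for the coordinate z that twists it.\<close>
  obtain T :: "'m set" where "card T = 3"
    using obtain_subset_with_card_n[of 3 "UNIV :: 'm set"] assms(1,2) by auto
  then obtain a b c :: 'm where abc: "a \<noteq> b" "a \<noteq> c" "b \<noteq> c" unfolding card_3_iff by blast
  have "card (- {h (a, False)}) = CARD('k)"
    using assms by (simp add: Compl_eq_Diff_UNIV card_Diff_subset)
  \<comment> \<open>The enumeration omits the real part of q_a, the coordinate on which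
    \<open>phi\<close> does not depend.\<close>
  then obtain e :: "'k \<Rightarrow> 'n" where e: "bij_betw e UNIV (- {h (a, False)})"
    using finite_same_card_bij[of "UNIV :: 'k set" "- {h (a, False)}"] by auto
  interpret twisted_projection h a b c e
    by unfold_locales (use h abc e in auto)
  show ?thesis
    using harmonic_morphism_phi hermitian_J holomorphic_phi not_kaehler factors_to_psi full_psi
      harmonic_morphism_psi submersion_psi
    by (intro exI[of _ phi] exI[of _ J] exI[of _ psi]) (auto simp: harmonic_morphism_def)
qed

end
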